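(* Let $\Omega,\Omega^*\subseteq\mathbb R^2$ be open and simply connected, $T:\Omega\to\Omega^*$ a $C^1$ bijective map, $Sx=Tx-x$, $a>0$, $\kappa_1>1$. For $x\in\Omega$ and $z\in\mathbb R$ with $a>z>\dfrac{|Sx|}{\sqrt{\kappa_1^2-1}}$ define $$V(x,z)=(V_1(x,z),V_2(x,z))=\frac{\kappa_1\dfrac{Sx}{z}}{\kappa_1-\sqrt{\left|\dfrac{Sx}{z}\right|^2+1}}.$$ Given $x_0\in\Omega$ satisfying $a>\dfrac{|Sx_0|}{\sqrt{\kappa_1^2-1}}$ and $z_0$ such that $a>z_0>\dfrac{|Sx_0|}{\sqrt{\kappa_1^2-1}}$, the identity $$\frac{\partial V_1}{\partial x_2}+\frac{\partial V_1}{\partial z}V_2=\frac{\partial V_2}{\partial x_1}+\frac{\partial V_2}{\partial z}V_1$$ is satisfied in an open neighborhood $\mathcal U\subseteq\left\{(x,z):x\in\Omega,\ a>z>\frac{|Sx|}{\sqrt{\kappa_1^2-1}}\right\}$ of $(x_0,z_0)$ if and only if for every $x$ in a neighborhood of $x_0$ $$\nabla\times S=0\qquad\text{and}\qquad S\times D|S|^2=0.$$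
   Context: For a planar $C^1$ field $S=(S_1,S_2)$ of $x=(x_1,x_2)$, $\nabla\times S=(S_2)_{x_1}-(S_1)_{x_2}$. For planar vectors ${\bf a}=(a_1,a_2)$, ${\bf b}=(b_1,b_2)$, ${\bf a}\times{\bf b}=a_1b_2-a_2b_1$. $D|S|^2$ is the gradient (row vector) of $x\mapsto|Sx|^2$. *)

theory Defs
  imports "HOL-Analysis.Analysis"
begin

definition C1_on :: "('a::real_normed_vector \<Rightarrow> 'b::real_normed_vector) \<Rightarrow> 'a set \<Rightarrow> bool" where
  "C1_on f U \<longleftrightarrow>
     (\<exists>f' :: 'a \<Rightarrow> 'a \<Rightarrow>\<^sub>L 'b.
        (\<forall>x\<in>U. (f has_derivative blinfun_apply (f' x)) (at x)) \<and> continuous_on U f')"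

definition partial :: "2 \<Rightarrow> (real^2 \<Rightarrow> real) \<Rightarrow> real^2 \<Rightarrow> real" where
  "partial i f x = deriv (\<lambda>t. f (x + t *\<^sub>R axis i 1)) 0"

definition gradient :: "(real^2 \<Rightarrow> real) \<Rightarrow> real^2 \<Rightarrow> real^2" where
  "gradient f x = (\<chi> i. partial i f x)"

definition curl :: "(real^2 \<Rightarrow> real^2) \<Rightarrow> real^2 \<Rightarrow> real" where
  "curl S x = partial 1 (\<lambda>y. S y $ 2) x - partial 2 (\<lambda>y. S y $ 1) x"

definition cross2 :: "real^2 \<Rightarrow> real^2 \<Rightarrow> real" where
  "cross2 a b = a $ 1 * b $ 2 - a $ 2 * b $ 1"

definition admissible :: "(real^2) set \<Rightarrow> (real^2 \<Rightarrow> real^2) \<Rightarrow> real \<Rightarrow> real \<Rightarrow> ((real^2) \<times> real) set" where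
  "admissible \<Omega> S a \<kappa>\<^sub>1 =
     {(x, z). x \<in> \<Omega> \<and> a > z \<and> z > norm (S x) / sqrt (\<kappa>\<^sub>1\<^sup>2 - 1)}"

text \<open>The formula for \<open>V\<close> is meaningful for \<open>(x, z)\<close> in the set \<open>admissible\<close>, where
  \<open>z\<close> and the denominator are positive.\<close>

definition V_field :: "(real^2 \<Rightarrow> real^2) \<Rightarrow> real \<Rightarrow> real^2 \<Rightarrow> real \<Rightarrow> real^2" where
  "V_field S \<kappa>\<^sub>1 x z =
     (\<kappa>\<^sub>1 *\<^sub>R (S x /\<^sub>R z)) /\<^sub>R (\<kappa>\<^sub>1 - sqrt ((norm (S x /\<^sub>R z))\<^sup>2 + 1))"

end

theory Submission
  imports Defs
begin

text \<open>For \<open>z > 0\<close> one has \<open>V = F \<cdot> S\<close> with \<open>F = \<kappa> / (\<kappa> z - r)\<close> and \<open>r\<^sup>2 = |S|\<^sup>2 + z\<^sup>2\<close>. The two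
  terms \<open>\<partial>\<^sub>z V\<^sub>1 V\<^sub>2\<close> and \<open>\<partial>\<^sub>z V\<^sub>2 V\<^sub>1\<close> both equal \<open>F\<^sub>z F S\<^sub>1 S\<^sub>2\<close> and cancel, so the identity
  at \<open>(x, z)\<close> amounts to \<open>2 r (\<kappa> z - r) (\<nabla> \<times> S) = S \<times> D|S|\<^sup>2\<close>. The factor \<open>r (\<kappa> z - r)\<close> is
  strictly increasing in \<open>z\<close>, whereas the other terms depend only on \<open>x\<close>; hence its validity at
  two heights above \<open>x\<close> forces both terms to vanish.\<close>

section \<open>Derivatives along coordinate lines, and the curl and cross terms in
  coordinates\<close>

lemma partial_eqI:
  assumes "((\<lambda>t. f (x + t *\<^sub>R axis i 1)) has_real_derivative D) (at 0)"
  shows "partial i f x = D"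
  using assms unfolding partial_def by (rule DERIV_imp_deriv)

text \<open>Since \<open>partial\<close> is a one-variable \<open>deriv\<close> at 0 along a line,
  this chain rule is how the total derivative of \<open>S\<close> enters all later
  computations.\<close>

lemma has_real_derivative_component_line:
  fixes S :: "'a::real_normed_vector \<Rightarrow> real^'n"
  assumes "(S has_derivative S') (at x)"
  shows "((\<lambda>t. S (x + t *\<^sub>R v) $ i) has_real_derivative S' v $ i) (at 0)"
proof -
  have "((\<lambda>t. x + t *\<^sub>R v) has_derivative (\<lambda>t. t *\<^sub>R v)) (at (0::real))"
    by (auto intro!: derivative_eq_intros)
  moreover have "(S has_derivative S') (at (x + (0::real) *\<^sub>R v))"
    using assms by simp
  ultimately have "((\<lambda>t. S (x + t *\<^sub>R v)) has_derivative (\<lambda>t. S' (t *\<^sub>R v))) (at (0::real))"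
    by (rule has_derivative_compose)
  then have "((\<lambda>t. S (x + t *\<^sub>R v) $ i) has_derivative (\<lambda>t. S' (t *\<^sub>R v) $ i)) (at (0::real))"
    by (rule bounded_linear.has_derivative[OF bounded_linear_vec_nth])
  moreover have "(\<lambda>t. S' (t *\<^sub>R v) $ i) = (*) (S' v $ i)"
    using has_derivative_bounded_linear[OF assms]
    by (auto simp: linear_simps fun_eq_iff)
  ultimately show ?thesis
    by (simp add: has_field_derivative_def)
qed

lemma has_real_derivative_sqrt_pos:
  assumes "(u has_real_derivative u') (at t)" "u t > 0"
  shows "((\<lambda>t. sqrt (u t)) has_real_derivative u' / (2 * sqrt (u t))) (at t)"
  by (rule DERIV_cong[OF DERIV_chain2[OF DERIV_real_sqrt[OF assms(2)] assms(1)]])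
    (simp add: field_simps)

lemma norm_sq_vec2: "(norm (v :: real^2))\<^sup>2 = (v $ 1)\<^sup>2 + (v $ 2)\<^sup>2"
  unfolding power2_norm_eq_inner inner_vec_def sum_2 by (simp add: power2_eq_square)

text \<open>Differentiating |S|^2 = S_1^2 + S_2^2 termwise puts the cross product in the entries of
  \<open>S'\<close>, the same quantities in which the partial derivatives of V are found.\<close>

lemma cross2_gradient_norm_sq:
  assumes "(S has_derivative S') (at x)"
  shows "cross2 (S x) (gradient (\<lambda>y. (norm (S y))\<^sup>2) x)
    = S x $ 1 * (2 * S x $ 1 * S' (axis 2 1) $ 1 + 2 * S x $ 2 * S' (axis 2 1) $ 2)
    - S x $ 2 * (2 * S x $ 1 * S' (axis 1 1) $ 1 + 2 * S x $ 2 * S' (axis 1 1) $ 2)"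
proof -
  have "partial i (\<lambda>y. (norm (S y))\<^sup>2) x
      = 2 * S x $ 1 * S' (axis i 1) $ 1 + 2 * S x $ 2 * S' (axis i 1) $ 2" for i
    unfolding norm_sq_vec2
    by (rule partial_eqI)
      (auto intro!: derivative_eq_intros has_real_derivative_component_line[OF assms])
  then show ?thesis
    by (simp add: cross2_def gradient_def)
qed

lemma curl_eq:
  assumes "(S has_derivative S') (at x)"
  shows "curl S x = S' (axis 1 1) $ 2 - S' (axis 2 1) $ 1"
  unfolding curl_def
  using partial_eqI[OF has_real_derivative_component_line[OF assms]] by simp

section \<open>Closed form of V and the admissible set\<close>

text \<open>For z > 0 the inner root is r / z, so expanding the fraction by z removes the quotients
  S / z and leaves a scalar that depends on x only through |S|^2.\<close>

lemma V_field_eq: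
  assumes "z > 0"
  shows "V_field S \<kappa> x z = (\<kappa> / (\<kappa> * z - sqrt ((norm (S x))\<^sup>2 + z\<^sup>2))) *\<^sub>R S x"
proof -
  have "(norm (S x /\<^sub>R z))\<^sup>2 + 1 = ((norm (S x))\<^sup>2 + z\<^sup>2) / z\<^sup>2"
    using assms by (simp add: field_simps power_mult_distrib)
  then have "sqrt ((norm (S x /\<^sub>R z))\<^sup>2 + 1) = sqrt ((norm (S x))\<^sup>2 + z\<^sup>2) / z"
    using assms by (simp add: real_sqrt_divide)
  then have "V_field S \<kappa> x z
      = (inverse (\<kappa> - sqrt ((norm (S x))\<^sup>2 + z\<^sup>2) / z) * (\<kappa> * inverse z)) *\<^sub>R S x"
    by (simp add: V_field_def)
  also have "\<kappa> - sqrt ((norm (S x))\<^sup>2 + z\<^sup>2) / z = (\<kappa> * z - sqrt ((norm (S x))\<^sup>2 + z\<^sup>2)) / z"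
    using assms by (simp add: field_simps)
  also have "inverse \<dots> * (\<kappa> * inverse z) = \<kappa> / (\<kappa> * z - sqrt ((norm (S x))\<^sup>2 + z\<^sup>2))"
    using assms by (simp add: divide_inverse)
  finally show ?thesis .
qed

text \<open>Squaring the lower bound on z gives |S|^2 < z^2 (\<kappa>^2 - 1), which is r^2 <
  (\<kappa> z)^2. This keeps the denominator of the closed form positive.\<close>

lemma admissible_pos:
  assumes "\<kappa> > 1" "(x, z) \<in> admissible \<Omega> S a \<kappa>"
  shows "z > 0" and "\<kappa> * z > sqrt ((norm (S x))\<^sup>2 + z\<^sup>2)"
proof -
  have k: "\<kappa>\<^sup>2 - 1 > 0"
    using assms(1) by (simp add: one_less_power)
  have z: "z > norm (S x) / sqrt (\<kappa>\<^sup>2 - 1)"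
    using assms(2) by (simp add: admissible_def)
  moreover have "norm (S x) / sqrt (\<kappa>\<^sup>2 - 1) \<ge> 0"
    using k by simp
  ultimately show "z > 0"
    by linarith
  have "norm (S x) < z * sqrt (\<kappa>\<^sup>2 - 1)"
    using z k by (simp add: field_simps)
  then have "(norm (S x))\<^sup>2 < (z * sqrt (\<kappa>\<^sup>2 - 1))\<^sup>2"
    by (rule power_strict_mono) auto
  also have "\<dots> = z\<^sup>2 * (\<kappa>\<^sup>2 - 1)"
    using k by (simp add: power_mult_distrib)
  finally have "(norm (S x))\<^sup>2 + z\<^sup>2 < (\<kappa> * z)\<^sup>2"
    by (simp add: algebra_simps power_mult_distrib)
  then show "\<kappa> * z > sqrt ((norm (S x))\<^sup>2 + z\<^sup>2)"
    using \<open>z > 0\<close> assms(1) by (intro real_less_lsqrt) auto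
qed

lemma open_admissible:
  assumes "open \<Omega>" "continuous_on \<Omega> S"
  shows "open (admissible \<Omega> S a \<kappa>)"
proof -
  \<comment> \<open>Multiplying by a constant inverse makes continuity free of the side condition
    that a divisor is nonzero.\<close>
  define g where "g p = norm (S (fst p)) * inverse (sqrt (\<kappa>\<^sup>2 - 1))" for p :: "(real^2) \<times> real"
  have "continuous_on (\<Omega> \<times> UNIV) (\<lambda>p :: (real^2) \<times> real. S (fst p))"
    by (rule continuous_on_compose2[OF assms(2) continuous_on_fst[OF continuous_on_id]]) auto
  then have "continuous_on (\<Omega> \<times> UNIV) (\<lambda>p. snd p - g p)"
    unfolding g_def
    by (intro continuous_on_diff continuous_on_snd continuous_on_id continuous_on_mult
        continuous_on_norm continuous_on_const)
  from continuous_open_preimage[OF this open_Times[OF assms(1) open_UNIV] open_greaterThan]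
  have "open ((\<Omega> \<times> UNIV) \<inter> (\<lambda>p. snd p - g p) -` {0<..})" .
  moreover have "open (UNIV \<times> {..<a} :: ((real^2) \<times> real) set)"
    by (rule open_Times[OF open_UNIV open_lessThan])
  ultimately have "open ((\<Omega> \<times> UNIV) \<inter> (\<lambda>p. snd p - g p) -` {0<..} \<inter> UNIV \<times> {..<a})"
    by (rule open_Int)
  also have "\<dots> = admissible \<Omega> S a \<kappa>"
    unfolding admissible_def divide_inverse g_def by auto
  finally show ?thesis .
qed

section \<open>The height factor and the pointwise form of the identity\<close>

text \<open>With r^2 = w + t^2 the derivative in t is (\<kappa> (r^2 + t^2) - 2 t r) / r. It is
  positive because 2 t r \<le> r^2 + t^2 and \<kappa> > 1.\<close>

lemma strict_mono_height_factor:
  fixes \<kappa> w z z' :: real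
  assumes "\<kappa> > 1" "w \<ge> 0" "0 < z" "z < z'"
  shows "sqrt (w + z\<^sup>2) * (\<kappa> * z - sqrt (w + z\<^sup>2)) < sqrt (w + z'\<^sup>2) * (\<kappa> * z' - sqrt (w + z'\<^sup>2))"
proof -
  have *: "\<exists>D. ((\<lambda>t. sqrt (w + t\<^sup>2) * (\<kappa> * t - sqrt (w + t\<^sup>2))) has_real_derivative D) (at t) \<and> D > 0"
    if "t \<ge> z" for t
  proof -
    have t: "t > 0"
      using that assms by simp
    define r where "r = sqrt (w + t\<^sup>2)"
    have pos: "w + t\<^sup>2 > 0"
      using t assms by (simp add: add_nonneg_pos)
    have r: "r > 0"
      unfolding r_def using pos by simp
    have "2 * t * r \<le> r\<^sup>2 + t\<^sup>2"
      using sum_squares_bound[of t r] by (simp add: add.commute)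
    also have "\<dots> < \<kappa> * (r\<^sup>2 + t\<^sup>2)"
      using assms(1) r by (simp add: add_pos_nonneg)
    finally have "2 * t * r < \<kappa> * (r\<^sup>2 + t\<^sup>2)" .
    then have "(\<kappa> * (r\<^sup>2 + t\<^sup>2) - 2 * t * r) / r > 0"
      using r by simp
    moreover have "((\<lambda>t. w + t\<^sup>2) has_real_derivative 2 * t) (at t)"
      by (auto intro!: derivative_eq_intros)
    from has_real_derivative_sqrt_pos[OF this pos]
    have "((\<lambda>t. sqrt (w + t\<^sup>2)) has_real_derivative t / r) (at t)"
      by (simp add: r_def)
    from DERIV_mult[OF this DERIV_diff[OF DERIV_cmult_Id[of \<kappa>] this]]
    have "((\<lambda>t. sqrt (w + t\<^sup>2) * (\<kappa> * t - sqrt (w + t\<^sup>2))) has_real_derivative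
        (\<kappa> * (r\<^sup>2 + t\<^sup>2) - 2 * t * r) / r) (at t)"
      by (rule DERIV_cong)
        (unfold r_def[symmetric], use r in \<open>simp add: field_simps power2_eq_square\<close>)
    ultimately show ?thesis
      by blast
  qed
  show ?thesis
    using assms(4) by (rule DERIV_pos_imp_increasing) (rule *)
qed

text \<open>By the product rule the difference of the two x-derivatives is F curl S + F_{x_1} S_2 -
  F_{x_2} S_1. The last two terms form a negative multiple of S \<times> D|S|^2, and a common
  nonzero factor can be divided out.\<close>

lemma identity_iff_curl:
  fixes S :: "real^2 \<Rightarrow> real^2" and V :: "real^2 \<Rightarrow> real \<Rightarrow> real^2"
  assumes "\<kappa> > 1" and openA: "open (admissible \<Omega> S a \<kappa>)"
    and V: "\<And>x z. (x, z) \<in> admissible \<Omega> S a \<kappa> \<Longrightarrow> V x z = V_field S \<kappa> x z"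
    and xz: "(x, z) \<in> admissible \<Omega> S a \<kappa>" and S': "(S has_derivative S') (at x)"
  defines "r \<equiv> sqrt ((norm (S x))\<^sup>2 + z\<^sup>2)"
  shows "partial 2 (\<lambda>y. V y z $ 1) x + deriv (\<lambda>t. V x t $ 1) z * V x z $ 2
       = partial 1 (\<lambda>y. V y z $ 2) x + deriv (\<lambda>t. V x t $ 2) z * V x z $ 1
     \<longleftrightarrow> 2 * (r * (\<kappa> * z - r)) * curl S x = cross2 (S x) (gradient (\<lambda>y. (norm (S y))\<^sup>2) x)"
proof -
  \<comment> \<open>The first argument stands for |S|^2, the only way in which the scalar factor
    depends on x.\<close>
  define F where "F w t = \<kappa> / (\<kappa> * t - sqrt (w + t\<^sup>2))" for w t :: real
  define d where "d = \<kappa> * z - r"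
  have z: "z > 0" and d: "d > 0"
    using admissible_pos[OF assms(1) xz] by (auto simp: r_def d_def)
  have pos: "(norm (S x))\<^sup>2 + z\<^sup>2 > 0"
    using z by (simp add: add_nonneg_pos)
  have r: "r > 0"
    unfolding r_def using pos by simp
  have V_eq: "V y t $ i = F ((norm (S y))\<^sup>2) t * S y $ i" if "(y, t) \<in> admissible \<Omega> S a \<kappa>" for y t i
    using V[OF that] V_field_eq[OF admissible_pos(1)[OF assms(1) that], of S \<kappa> y]
    by (simp add: F_def)

  have "((\<lambda>t. (norm (S x))\<^sup>2 + t\<^sup>2) has_real_derivative 2 * z) (at z)"
    by (auto intro!: derivative_eq_intros)
  note D = DERIV_diff[OF DERIV_cmult_Id[of \<kappa>] has_real_derivative_sqrt_pos[OF this pos]]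
  \<comment> \<open>Existence suffices: \<open>Fz\<close> enters both mixed terms in the same way
    and cancels.\<close>
  have "\<exists>D. (F ((norm (S x))\<^sup>2) has_real_derivative D) (at z)"
    unfolding F_def
    by (rule exI, rule DERIV_divide[OF DERIV_const D]) (use d in \<open>simp add: d_def r_def\<close>)
  then obtain Fz where Fz: "(F ((norm (S x))\<^sup>2) has_real_derivative Fz) (at z)" ..
  have "deriv (\<lambda>t. V x t $ i) z = Fz * S x $ i" for i
  proof -
    \<comment> \<open>\<open>V\<close> is prescribed only on the admissible set; openness makes the
      closed form valid for all t near z, and \<open>deriv\<close> sees nothing else.\<close>
    have "open ((\<lambda>t. (x, t)) -` admissible \<Omega> S a \<kappa>)"
      by (rule open_vimage[OF openA]) (auto intro!: continuous_intros)
    then have "eventually (\<lambda>t. (x, t) \<in> admissible \<Omega> S a \<kappa>) (nhds z)"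
      using xz by (auto simp: eventually_nhds)
    then have "eventually (\<lambda>t. V x t $ i = F ((norm (S x))\<^sup>2) t * S x $ i) (nhds z)"
      by eventually_elim (rule V_eq)
    then have "deriv (\<lambda>t. V x t $ i) z = deriv (\<lambda>t. F ((norm (S x))\<^sup>2) t * S x $ i) z"
      by (rule deriv_cong_ev) simp
    also have "\<dots> = Fz * S x $ i"
      by (rule DERIV_imp_deriv) (auto intro!: derivative_eq_intros Fz)
    finally show ?thesis .
  qed
  then have cancel: "deriv (\<lambda>t. V x t $ 1) z * V x z $ 2 = deriv (\<lambda>t. V x t $ 2) z * V x z $ 1"
    using V_eq[OF xz] by simp

  \<comment> \<open>\<open>w' j\<close> is the j-th partial derivative of |S|^2, in the form found
    in \<open>cross2_gradient_norm_sq\<close>.\<close>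
  define w' where "w' j = 2 * S x $ 1 * S' (axis j 1) $ 1 + 2 * S x $ 2 * S' (axis j 1) $ 2" for j
  have part: "partial j (\<lambda>y. V y z $ i) x
      = \<kappa> / d * S' (axis j 1) $ i + \<kappa> * w' j / (2 * r * d\<^sup>2) * S x $ i" for i j
  proof -
    let ?l = "\<lambda>t::real. x + t *\<^sub>R axis j 1"
    have "open ((\<lambda>t. (?l t, z)) -` admissible \<Omega> S a \<kappa>)"
      by (rule open_vimage[OF openA]) (auto intro!: continuous_intros)
    then have "eventually (\<lambda>t. (?l t, z) \<in> admissible \<Omega> S a \<kappa>) (nhds 0)"
      using xz by (auto simp: eventually_nhds)
    then have ev: "eventually (\<lambda>t. V (?l t) z $ i = F ((norm (S (?l t)))\<^sup>2) z * S (?l t) $ i) (nhds 0)"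
      by eventually_elim (rule V_eq)
    have "((\<lambda>t. (norm (S (?l t)))\<^sup>2 + z\<^sup>2) has_real_derivative w' j) (at 0)"
      unfolding norm_sq_vec2 w'_def
      by (auto intro!: derivative_eq_intros has_real_derivative_component_line[OF S'])
    then have sqrt_deriv: "((\<lambda>t. sqrt ((norm (S (?l t)))\<^sup>2 + z\<^sup>2)) has_real_derivative w' j / (2 * r)) (at 0)"
      using has_real_derivative_sqrt_pos[of "\<lambda>t. (norm (S (?l t)))\<^sup>2 + z\<^sup>2" "w' j" 0] pos
      by (simp add: r_def)
    \<comment> \<open>The quotient rule produces the denominator at \<open>?l 0\<close>; this folds
      it to \<open>d\<close> before field simplification.\<close>
    have d_eq: "\<kappa> * z - sqrt ((norm (S (?l 0)))\<^sup>2 + z\<^sup>2) = d"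
      by (simp add: d_def r_def)
    have "((\<lambda>t. F ((norm (S (?l t)))\<^sup>2) z) has_real_derivative \<kappa> * w' j / (2 * r * d\<^sup>2)) (at 0)"
      unfolding F_def
      by (rule DERIV_cong[OF DERIV_divide[OF DERIV_const DERIV_diff[OF DERIV_const sqrt_deriv]]])
        (simp_all only: d_eq, use d r in \<open>simp_all add: field_simps power2_eq_square\<close>)
    from DERIV_mult[OF this has_real_derivative_component_line[OF S', of "axis j 1" i]]
    have "((\<lambda>t. F ((norm (S (?l t)))\<^sup>2) z * S (?l t) $ i) has_real_derivative
        \<kappa> / d * S' (axis j 1) $ i + \<kappa> * w' j / (2 * r * d\<^sup>2) * S x $ i) (at 0)"
      by (rule DERIV_cong) (simp add: F_def d_def r_def)
    then show ?thesis
      by (intro partial_eqI) (rule DERIV_cong_ev[OF refl ev refl, THEN iffD2])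
  qed

  have "partial 1 (\<lambda>y. V y z $ 2) x - partial 2 (\<lambda>y. V y z $ 1) x
      = \<kappa> / (2 * r * d\<^sup>2) * (2 * (r * d) * curl S x
          - cross2 (S x) (gradient (\<lambda>y. (norm (S y))\<^sup>2) x))"
    unfolding part cross2_gradient_norm_sq[OF S'] curl_eq[OF S'] w'_def
    using d r by (simp add: field_simps power2_eq_square)
  moreover have "\<kappa> / (2 * r * d\<^sup>2) \<noteq> 0"
    using assms(1) d r by simp
  ultimately show ?thesis
    unfolding cancel d_def[symmetric] by (smt (verit) mult_eq_0_iff)
qed

section \<open>From the pointwise form to neighbourhoods\<close>

theorem theorem4p2:
  fixes \<Omega> \<Omega>' :: "(real^2) set"
    and T S :: "real^2 \<Rightarrow> real^2"
    and V :: "real^2 \<Rightarrow> real \<Rightarrow> real^2"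
    and a \<kappa>\<^sub>1 z\<^sub>0 :: real
    and x\<^sub>0 :: "real^2"
  assumes "open \<Omega>" and "simply_connected \<Omega>"
    and "open \<Omega>'" and "simply_connected \<Omega>'"
    and "C1_on T \<Omega>" and "bij_betw T \<Omega> \<Omega>'"
    and "\<And>x. x \<in> \<Omega> \<Longrightarrow> S x = T x - x"
    and "a > 0" and "\<kappa>\<^sub>1 > 1"
    and "\<And>x z. (x, z) \<in> admissible \<Omega> S a \<kappa>\<^sub>1 \<Longrightarrow> V x z = V_field S \<kappa>\<^sub>1 x z"
    and "x\<^sub>0 \<in> \<Omega>" and "a > norm (S x\<^sub>0) / sqrt (\<kappa>\<^sub>1\<^sup>2 - 1)"
    and "a > z\<^sub>0" and "z\<^sub>0 > norm (S x\<^sub>0) / sqrt (\<kappa>\<^sub>1\<^sup>2 - 1)"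
  shows "(\<exists>U. open U \<and> (x\<^sub>0, z\<^sub>0) \<in> U \<and> U \<subseteq> admissible \<Omega> S a \<kappa>\<^sub>1 \<and>
            (\<forall>(x, z)\<in>U.
               partial 2 (\<lambda>y. V y z $ 1) x + deriv (\<lambda>t. V x t $ 1) z * V x z $ 2
             = partial 1 (\<lambda>y. V y z $ 2) x + deriv (\<lambda>t. V x t $ 2) z * V x z $ 1))
     \<longleftrightarrow>
         (\<exists>N. open N \<and> x\<^sub>0 \<in> N \<and> N \<subseteq> \<Omega> \<and>
            (\<forall>x\<in>N. curl S x = 0 \<and> cross2 (S x) (gradient (\<lambda>y. (norm (S y))\<^sup>2) x) = 0))"
proof -
  let ?A = "admissible \<Omega> S a \<kappa>\<^sub>1"
  let ?Q = "\<lambda>x. cross2 (S x) (gradient (\<lambda>y. (norm (S y))\<^sup>2) x)"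
  let ?h = "\<lambda>x z. sqrt ((norm (S x))\<^sup>2 + z\<^sup>2) * (\<kappa>\<^sub>1 * z - sqrt ((norm (S x))\<^sup>2 + z\<^sup>2))"
  obtain T' where T': "\<forall>x\<in>\<Omega>. (T has_derivative blinfun_apply (T' x)) (at x)"
    using assms(5) unfolding C1_on_def by (elim exE conjE) (rule that)
  have S': "(S has_derivative (\<lambda>h. T' x h - h)) (at x)" if "x \<in> \<Omega>" for x
  proof -
    have "((\<lambda>y. T y - y) has_derivative (\<lambda>h. T' x h - h)) (at x)"
      by (rule has_derivative_diff[OF bspec[OF T' that] has_derivative_ident])
    \<comment> \<open>\<open>S\<close> is tied to \<open>T\<close> only on the open set \<Omega>,
      which is enough to transfer the derivative at its points.\<close>
    then show ?thesis
      by (rule has_derivative_transform_within_open[OF _ assms(1) that]) (simp add: assms(7))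
  qed
  have "continuous_on \<Omega> S"
    by (intro continuous_at_imp_continuous_on ballI) (rule has_derivative_continuous[OF S'])
  with assms(1) have openA: "open ?A"
    by (rule open_admissible)
  have in_\<Omega>: "x \<in> \<Omega>" if "(x, z) \<in> ?A" for x z
    using that by (simp add: admissible_def)
  have iff: "partial 2 (\<lambda>y. V y z $ 1) x + deriv (\<lambda>t. V x t $ 1) z * V x z $ 2
           = partial 1 (\<lambda>y. V y z $ 2) x + deriv (\<lambda>t. V x t $ 2) z * V x z $ 1
      \<longleftrightarrow> 2 * ?h x z * curl S x = ?Q x" if "(x, z) \<in> ?A" for x z
    using identity_iff_curl[OF assms(9) openA assms(10) that S'[OF in_\<Omega>[OF that]]] .
  show ?thesis
  proof
    assume "\<exists>U. open U \<and> (x\<^sub>0, z\<^sub>0) \<in> U \<and> U \<subseteq> ?A \<and>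
            (\<forall>(x, z)\<in>U.
               partial 2 (\<lambda>y. V y z $ 1) x + deriv (\<lambda>t. V x t $ 1) z * V x z $ 2
             = partial 1 (\<lambda>y. V y z $ 2) x + deriv (\<lambda>t. V x t $ 2) z * V x z $ 1)"
    then obtain U where U: "open U" "(x\<^sub>0, z\<^sub>0) \<in> U" "U \<subseteq> ?A"
      and eq: "\<And>x z. (x, z) \<in> U \<Longrightarrow> 2 * ?h x z * curl S x = ?Q x"
      using iff by (fast dest: subsetD)
    \<comment> \<open>A product neighbourhood provides the same two heights \<open>z\<^sub>0\<close>
      and \<open>z\<^sub>1\<close> above every x in \<open>N\<close>.\<close>
    obtain N I where NI: "open N" "open I" "x\<^sub>0 \<in> N" "z\<^sub>0 \<in> I" "N \<times> I \<subseteq> U"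
      using open_prod_elim[OF U(1,2)] by (metis mem_Sigma_iff)
    obtain z\<^sub>1 where z\<^sub>1: "z\<^sub>1 > z\<^sub>0" "z\<^sub>1 \<in> I"
    proof -
      obtain e where "e > 0" "ball z\<^sub>0 e \<subseteq> I"
        using NI(2,4) open_contains_ball by blast
      then show ?thesis
        by (intro that[of "z\<^sub>0 + e / 2"]) (auto simp: dist_real_def)
    qed
    have "curl S x = 0 \<and> ?Q x = 0" if "x \<in> N" for x
    proof -
      have xU: "(x, z\<^sub>0) \<in> U" "(x, z\<^sub>1) \<in> U"
        using that NI z\<^sub>1 by auto
      then have "z\<^sub>0 > 0"
        using U(3) admissible_pos(1)[OF assms(9)] by blast
      then have "?h x z\<^sub>0 < ?h x z\<^sub>1"
        by (intro strict_mono_height_factor assms(9) z\<^sub>1(1)) auto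
      \<comment> \<open>Both sides equal \<open>?Q x\<close>, which does not involve z; as the
        factors \<open>?h\<close> differ, the curl must vanish, and then \<open>?Q x\<close> does
        too.\<close>
      moreover have "2 * ?h x z\<^sub>0 * curl S x = 2 * ?h x z\<^sub>1 * curl S x"
        using eq[OF xU(1)] eq[OF xU(2)] by simp
      ultimately have "curl S x = 0"
        by auto
      then show ?thesis
        using eq[OF xU(1)] by simp
    qed
    moreover have "N \<subseteq> \<Omega>"
      using NI U(3) in_\<Omega> by blast
    ultimately show "\<exists>N. open N \<and> x\<^sub>0 \<in> N \<and> N \<subseteq> \<Omega> \<and> (\<forall>x\<in>N. curl S x = 0 \<and> ?Q x = 0)"
      using NI by blast
  next
    assume "\<exists>N. open N \<and> x\<^sub>0 \<in> N \<and> N \<subseteq> \<Omega> \<and> (\<forall>x\<in>N. curl S x = 0 \<and> ?Q x = 0)"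
    then obtain N where N: "open N" "x\<^sub>0 \<in> N" "\<And>x. x \<in> N \<Longrightarrow> curl S x = 0 \<and> ?Q x = 0"
      by blast
    \<comment> \<open>The witness consists of all admissible points above \<open>N\<close>: there
      both sides of the pointwise form are zero at every height.\<close>
    have "open (?A \<inter> N \<times> UNIV)"
      by (intro open_Int openA open_Times N(1) open_UNIV)
    moreover have "(x\<^sub>0, z\<^sub>0) \<in> ?A \<inter> N \<times> UNIV"
      using assms(11,13,14) N(2) by (simp add: admissible_def)
    moreover have "\<forall>(x, z)\<in>?A \<inter> N \<times> UNIV.
               partial 2 (\<lambda>y. V y z $ 1) x + deriv (\<lambda>t. V x t $ 1) z * V x z $ 2
             = partial 1 (\<lambda>y. V y z $ 2) x + deriv (\<lambda>t. V x t $ 2) z * V x z $ 1"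
      using iff N(3) by auto
    ultimately show "\<exists>U. open U \<and> (x\<^sub>0, z\<^sub>0) \<in> U \<and> U \<subseteq> ?A \<and>
            (\<forall>(x, z)\<in>U.
               partial 2 (\<lambda>y. V y z $ 1) x + deriv (\<lambda>t. V x t $ 1) z * V x z $ 2
             = partial 1 (\<lambda>y. V y z $ 2) x + deriv (\<lambda>t. V x t $ 2) z * V x z $ 1)"
      by (intro exI[of _ "?A \<inter> N \<times> UNIV"]) blast
  qed
qed

end
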